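(* Let $\widehat G=(V,E)$ be a finite connected tadpole-free undirected graph (multiple edges allowed), with $n=|V|$, $m=|E|$ and $L(\widehat G)=m-n+1$. Suppose the edge parameters are specialized so that $\overline\beta_u=\beta$ for every $u\in E$, with $\beta\neq0$. Then $$\sum_{G\in\operatorname{Ori}(\widehat G)}\omega_c(G;\boldsymbol\beta)=(-1)^{n-1}\,\beta^{L(\widehat G)}\,T_{\widehat G}\Bigl(1,\,1-\frac1\beta\Bigr),$$ where $T_{\widehat G}(x,y)$ is the Tutte polynomial of $\widehat G$.
   Context: $\operatorname{Ori}(\widehat G)$ is the set of the $2^{|E|}$ quivers obtained by choosing independently one of the two orientations of every edge of $\widehat G$ (parallel edges are distinct). For $u\in E$ with its two orientations $\varepsilon,\bar\varepsilon$, parameters $\beta_\varepsilon,\beta_{\bar\varepsilon}$ are attached and $\overline\beta_u=(\beta_\varepsilon+\beta_{\bar\varepsilon})/2$. In $\omega_c(G;\boldsymbol\beta)$ each oriented edge uses the parameter of its chosen orientation. For connected $\widehat G$, $T_{\widehat G}(1,y)=\sum_{F\subseteq E,\ (V,F)\text{ connected}}(y-1)^{|F|-n+1}$. Definition of $\omega_c$. A (finite) quiver $G=(V_G,E_G,\rho_G)$ has finite sets $V_G,E_G$ and $\rho_G:E_G\to V_G\times V_G$, where $\rho_G(\varepsilon)=(u,v)$ is written $\varepsilon:u\to v$; parallel edges, directed cycles and tadpoles (edges $u\to u$) are allowed; acyclic means no directed cycle (tadpoles count as directed cycles); connected means nonempty with connected underlying undirected graph. Edges carry parameters $\beta_\varepsilon$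 over a field of characteristic zero, kept by edges surviving in subquivers/contractions; $\beta_{\varepsilon,\pm}=(\beta_\varepsilon\pm1)/2$. A cut-subquiver $H\preceq G$ has vertex set $V_G$ and any $E_H\subseteq E_G$; the contraction $G/H$ has vertices the connected components of $H$ and edges $E_G\setminus E_H$ with induced incidences. For tadpole-free $G$, $e_0(G)=|\operatorname{LE}(G)|/|V_G|!$ if $G$ is acyclic ($\operatorname{LE}(G)$ = linear extensions of the partial order induced by the edges), $e_0(G)=0$ otherwise; in general $e(G;\boldsymbol\beta)=\bigl(\prod_{\varepsilon\text{ tadpole}}(-\beta_{\varepsilon,-})\bigr)e_0(G_{\mathrm{pruned}})$ with $G_{\mathrm{pruned}}$ obtained by deleting all tadpoles. $\omega$ is the unique function on quivers with $\sum_{H\preceq G}\omega(H)e(G/H)=\epsilon(G)$, $\epsilon(G)=1$ if $E_G=\emptyset$ and $0$ otherwise; $\omega_c(G)=\omega(G)$ for connected $G$, and $\omega_c(G)=0$ otherwise. *)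

theory Defs
  imports "Graph_Theory.Graph_Theory" "HOL-Library.FuncSet" Complex_Main
begin

text \<open>A finite quiver is a Graph_Theory \<open>fin_digraph\<close>: parallel arcs and loops (tadpoles) are allowed,
  and the null graph is included.  The library's \<open>connected\<close> is weak connectedness together with
  nonemptiness, and \<open>spanning H G\<close> says that \<open>H\<close> has the same vertices, tail and head maps as \<open>G\<close> and
  \<open>arcs H \<subseteq> arcs G\<close>, i.e. that \<open>H\<close> is a cut-subquiver of \<open>G\<close>.  Parameters are functions on the arc
  type; since arcs keep their names in subquivers and contractions, they keep their parameters.\<close>

type_synonym ('v, 'a) quiver = "('v, 'a) pre_digraph"

definition tadpoles :: "('v, 'a) quiver \<Rightarrow> 'a set" where
  "tadpoles G = {\<epsilon> \<in> arcs G. tail G \<epsilon> = head G \<epsilon>}"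

definition prune :: "('v, 'a) quiver \<Rightarrow> ('v, 'a) quiver" where
  "prune G = G\<lparr>arcs := arcs G - tadpoles G\<rparr>"

definition acyclic_quiver :: "('v, 'a) quiver \<Rightarrow> bool" where
  "acyclic_quiver G \<longleftrightarrow> \<not> (\<exists>p. pre_digraph.cycle G p)"

definition linear_extensions :: "('v, 'a) quiver \<Rightarrow> 'v rel set" where
  "linear_extensions G = {r. linear_order_on (verts G) r \<and> {(u, v). u \<rightarrow>\<^sup>*\<^bsub>G\<^esub> v} \<subseteq> r}"

definition e0 :: "('v, 'a) quiver \<Rightarrow> 'k::field_char_0" where
  "e0 G = (if acyclic_quiver G
           then of_nat (card (linear_extensions G)) / fact (card (verts G)) else 0)"

definition beta_minus :: "('a \<Rightarrow> 'k::field_char_0) \<Rightarrow> 'a \<Rightarrow> 'k" where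
  "beta_minus \<beta> \<epsilon> = (\<beta> \<epsilon> - 1) / 2"

definition e_char :: "('v, 'a) quiver \<Rightarrow> ('a \<Rightarrow> 'k::field_char_0) \<Rightarrow> 'k" where
  "e_char G \<beta> = (\<Prod>\<epsilon>\<in>tadpoles G. - beta_minus \<beta> \<epsilon>) * e0 (prune G)"

definition eps_char :: "('v, 'a) quiver \<Rightarrow> 'k::field_char_0" where
  "eps_char G = (if arcs G = {} then 1 else 0)"

text \<open>Connected components of the underlying undirected graph are the strong components of its
  symmetrization.\<close>

definition components :: "('v, 'a) quiver \<Rightarrow> 'v set set" where
  "components H = pre_digraph.sccs_verts (mk_symmetric H)"

definition component_of :: "('v, 'a) quiver \<Rightarrow> 'v \<Rightarrow> 'v set" where
  "component_of H v = pre_digraph.scc_of (mk_symmetric H) v"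

definition contraction :: "('v, 'a) quiver \<Rightarrow> ('v, 'a) quiver \<Rightarrow> ('v set, 'a) quiver" where
  "contraction G H = \<lparr> verts = components H, arcs = arcs G - arcs H,
     tail = (\<lambda>\<epsilon>. component_of H (tail G \<epsilon>)), head = (\<lambda>\<epsilon>. component_of H (head G \<epsilon>)) \<rparr>"

text \<open>The last clause only fixes a value off the finite quivers, so that \<open>\<omega>\<close> is unique as a total
  function.\<close>

definition is_omega ::
    "(('v, 'a) quiver \<Rightarrow> ('a \<Rightarrow> 'k::field_char_0) \<Rightarrow> 'k) \<Rightarrow> bool" where
  "is_omega w \<longleftrightarrow>
     (\<forall>G \<beta>. fin_digraph G \<longrightarrow>
        (\<Sum>H | spanning H G. w H \<beta> * e_char (contraction G H) \<beta>) = eps_char G) \<and>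
     (\<forall>G \<beta>. \<not> fin_digraph G \<longrightarrow> w G \<beta> = 0)"

definition omega :: "('v, 'a) quiver \<Rightarrow> ('a \<Rightarrow> 'k::field_char_0) \<Rightarrow> 'k" where
  "omega = (THE w. is_omega w)"

definition omega_c :: "('v, 'a) quiver \<Rightarrow> ('a \<Rightarrow> 'k::field_char_0) \<Rightarrow> 'k" where
  "omega_c G \<beta> = (if connected G then omega G \<beta> else 0)"


text \<open>Finite undirected graphs with multiple edges; a tadpole is an edge with a single endpoint.\<close>

record ('v, 'e) ugraph =
  nodes :: "'v set"
  edges :: "'e set"
  ends :: "'e \<Rightarrow> 'v set"

definition fin_ugraph :: "('v, 'e) ugraph \<Rightarrow> bool" where
  "fin_ugraph \<Gamma> \<longleftrightarrow> finite (nodes \<Gamma>) \<and> finite (edges \<Gamma>) \<and>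
     (\<forall>u\<in>edges \<Gamma>. ends \<Gamma> u \<subseteq> nodes \<Gamma> \<and> card (ends \<Gamma> u) \<in> {1, 2})"

definition tadpole_free :: "('v, 'e) ugraph \<Rightarrow> bool" where
  "tadpole_free \<Gamma> \<longleftrightarrow> (\<forall>u\<in>edges \<Gamma>. card (ends \<Gamma> u) \<noteq> 1)"

text \<open>The oriented edge \<open>(u, a, b)\<close> is the edge \<open>u\<close> directed from \<open>a\<close> to \<open>b\<close>.\<close>

type_synonym ('v, 'e) oedge = "'e \<times> 'v \<times> 'v"

definition orientations :: "('v, 'e) ugraph \<Rightarrow> 'e \<Rightarrow> ('v, 'e) oedge set" where
  "orientations \<Gamma> u = {(u, a, b) | a b. ends \<Gamma> u = {a, b}}"

definition oquiver :: "('v, 'e) ugraph \<Rightarrow> ('v, 'e) oedge set \<Rightarrow> ('v, ('v, 'e) oedge) quiver" where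
  "oquiver \<Gamma> A = \<lparr> verts = nodes \<Gamma>, arcs = A,
     tail = (\<lambda>(u, a, b). a), head = (\<lambda>(u, a, b). b) \<rparr>"

definition Ori :: "('v, 'e) ugraph \<Rightarrow> ('v, ('v, 'e) oedge) quiver set" where
  "Ori \<Gamma> = (\<lambda>s. oquiver \<Gamma> (s ` edges \<Gamma>)) ` (\<Pi>\<^sub>E u\<in>edges \<Gamma>. orientations \<Gamma> u)"

definition mean_param :: "('v, 'e) ugraph \<Rightarrow> (('v, 'e) oedge \<Rightarrow> 'k::field_char_0) \<Rightarrow> 'e \<Rightarrow> 'k" where
  "mean_param \<Gamma> \<beta> u = (\<Sum>\<epsilon>\<in>orientations \<Gamma> u. \<beta> \<epsilon>) / 2"

text \<open>The spanning subgraph \<open>(V, F)\<close>, with each of its edges taken in both directions.\<close>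

definition both_ways :: "('v, 'e) ugraph \<Rightarrow> 'e set \<Rightarrow> ('v, ('v, 'e) oedge) quiver" where
  "both_ways \<Gamma> F = oquiver \<Gamma> (\<Union>u\<in>F. orientations \<Gamma> u)"

definition uconnected :: "('v, 'e) ugraph \<Rightarrow> 'e set \<Rightarrow> bool" where
  "uconnected \<Gamma> F \<longleftrightarrow> connected (both_ways \<Gamma> F)"

definition ncomps :: "('v, 'e) ugraph \<Rightarrow> 'e set \<Rightarrow> nat" where
  "ncomps \<Gamma> F = card (components (both_ways \<Gamma> F))"

text \<open>The natural-number subtractions do not truncate: \<open>ncomps \<Gamma> F \<ge> ncomps \<Gamma> (edges \<Gamma>)\<close> and
  \<open>ncomps \<Gamma> F + card F \<ge> card (nodes \<Gamma>)\<close>.\<close>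

definition tutte :: "('v, 'e) ugraph \<Rightarrow> 'k::field_char_0 \<Rightarrow> 'k \<Rightarrow> 'k" where
  "tutte \<Gamma> x y = (\<Sum>F\<in>Pow (edges \<Gamma>).
     (x - 1) ^ (ncomps \<Gamma> F - ncomps \<Gamma> (edges \<Gamma>)) *
     (y - 1) ^ (ncomps \<Gamma> F + card F - card (nodes \<Gamma>)))"



lemma finite_spanning:
  assumes "fin_digraph G" shows "finite {H. spanning H G}"
proof (rule finite_surj[of "Pow (arcs G)" _ "\<lambda>F. G\<lparr>arcs := F\<rparr>"])
  show "finite (Pow (arcs G))" using assms by (simp add: fin_digraph.finite_arcs)
  show "{H. spanning H G} \<subseteq> (\<lambda>F. G\<lparr>arcs := F\<rparr>) ` Pow (arcs G)"
  proof
    fix H assume "H \<in> {H. spanning H G}"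
    then have "H = G\<lparr>arcs := arcs H\<rparr>" "arcs H \<subseteq> arcs G"
      by (auto simp: spanning_def subgraph_def compatible_def)
    then show "H \<in> (\<lambda>F. G\<lparr>arcs := F\<rparr>) ` Pow (arcs G)" by blast
  qed
qed

lemma spanning_iff:
  assumes "wf_digraph G"
  shows "spanning H G \<longleftrightarrow> (\<exists>F \<subseteq> arcs G. H = G\<lparr>arcs := F\<rparr>)"
proof
  assume "spanning H G"
  then have "H = G\<lparr>arcs := arcs H\<rparr>" "arcs H \<subseteq> arcs G"
    by (auto simp: spanning_def subgraph_def compatible_def)
  then show "\<exists>F \<subseteq> arcs G. H = G\<lparr>arcs := F\<rparr>" by blast
next
  assume "\<exists>F \<subseteq> arcs G. H = G\<lparr>arcs := F\<rparr>"
  then show "spanning H G"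
    using assms by (auto simp: spanning_def subgraph_def compatible_def wf_digraph_def)
qed

lemma spanning_fin:
  assumes "fin_digraph G" "spanning H G" shows "fin_digraph H"
  using assms unfolding spanning_def subgraph_def fin_digraph_def fin_digraph_axioms_def
  by (auto intro: finite_subset)

lemma spanning_card_less:
  assumes "fin_digraph G" "spanning H G" "H \<noteq> G"
  shows "card (arcs H) < card (arcs G)"
proof -
  have "arcs H \<subseteq> arcs G" "arcs H \<noteq> arcs G"
    using assms by (auto simp: spanning_def subgraph_def compatible_def)
  then show ?thesis using fin_digraph.finite_arcs[OF assms(1)] by (meson psubsetI psubset_card_mono)
qed

lemma spanning_self: "fin_digraph G \<Longrightarrow> spanning G G"
  by (auto simp: spanning_def subgraph_def compatible_def fin_digraph_def)

lemma components_conv: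
  assumes "wf_digraph H"
  shows "components H = component_of H ` verts H"
proof -
  interpret wf_digraph H by fact
  interpret S: pair_wf_digraph "mk_symmetric H" ..
  show ?thesis
    using S.sccs_verts_conv_scc_of unfolding components_def component_of_def by simp
qed

lemma component_of_iff:
  assumes "wf_digraph H"
  shows "w \<in> component_of H v \<longleftrightarrow> v \<rightarrow>\<^sup>*\<^bsub>mk_symmetric H\<^esub> w"
proof -
  have "symmetric (with_proj (mk_symmetric H))"
    by (auto simp: symmetric_def sym_def arcs_ends_conv mk_symmetric_def)
  from symmetric_reachable[OF this]
  show ?thesis unfolding component_of_def pre_digraph.scc_of_def by blast
qed

lemma card_components_eq_1_iff:
  assumes "wf_digraph H"
  shows "card (components H) = 1 \<longleftrightarrow> connected H"
proof
  assume "card (components H) = 1"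
  then obtain S where S: "component_of H ` verts H = {S}"
    using components_conv[OF assms] by (auto simp: card_Suc_eq)
  then have ne: "verts H \<noteq> {}" by auto
  have "u \<rightarrow>\<^sup>*\<^bsub>mk_symmetric H\<^esub> v" if "u \<in> verts H" "v \<in> verts H" for u v
  proof -
    have "v \<rightarrow>\<^sup>*\<^bsub>mk_symmetric H\<^esub> v" using that by (auto simp: reachable_def mk_symmetric_def)
    then have "v \<in> component_of H v" by (simp add: component_of_iff[OF assms])
    moreover have "component_of H v = component_of H u" using S that by blast
    ultimately show ?thesis by (simp add: component_of_iff[OF assms])
  qed
  with ne show "connected H"
    unfolding connected_def strongly_connected_def by (auto simp: mk_symmetric_def)
next
  assume c: "connected H"
  then have ne: "verts H \<noteq> {}" and all: "\<And>u v. u \<in> verts H \<Longrightarrow> v \<in> verts H \<Longrightarrow> u \<rightarrow>\<^sup>*\<^bsub>mk_symmetric H\<^esub> v"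
    unfolding connected_def strongly_connected_def by (auto simp: mk_symmetric_def)
  have "component_of H u = verts H" if "u \<in> verts H" for u
  proof -
    have "w \<in> verts H" if "u \<rightarrow>\<^sup>*\<^bsub>mk_symmetric H\<^esub> w" for w
      using that by (rule reachable_in_vertsE) (simp add: mk_symmetric_def)
    then show ?thesis using all[OF that] by (auto simp: component_of_iff[OF assms])
  qed
  with ne have "component_of H ` verts H = {verts H}" by auto
  then show "card (components H) = 1" by (simp add: components_conv[OF assms])
qed

lemma linear_order_on_insert_min:
  assumes "x \<in> A" "linear_order_on (A - {x}) r"
  shows "linear_order_on A (r \<union> {x} \<times> A)"
  using assms
  unfolding linear_order_on_def partial_order_on_def preorder_on_def refl_on_def trans_def
    antisym_def total_on_def
  by safe blast+

lemma linear_order_on_remove: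
  assumes "linear_order_on A r"
  shows "linear_order_on (A - {x}) (r \<inter> (A - {x}) \<times> (A - {x}))"
  using assms
  unfolding linear_order_on_def partial_order_on_def preorder_on_def refl_on_def trans_def
    antisym_def total_on_def
  by (intro conjI; blast)

lemma linear_order_on_has_min:
  assumes "finite A" "A \<noteq> {}" "linear_order_on A r"
  shows "\<exists>x\<in>A. \<forall>y\<in>A. (x, y) \<in> r"
proof -
  have "\<exists>x\<in>B. \<forall>y\<in>B. (x, y) \<in> r" if "finite B" "B \<noteq> {}" "B \<subseteq> A" for B
    using that
  proof (induction rule: finite_ne_induct)
    case (singleton x)
    then show ?case
      using assms(3) by (auto simp: linear_order_on_def partial_order_on_def preorder_on_def refl_on_def)
  next
    case (insert x B)
    then obtain m where m: "m \<in> B" "\<And>y. y \<in> B \<Longrightarrow> (m, y) \<in> r" by auto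
    have tr: "trans r" and xx: "(x, x) \<in> r" and cmp: "(x, m) \<in> r \<or> (m, x) \<in> r"
      using assms(3) insert m(1)
      by (auto simp: linear_order_on_def partial_order_on_def preorder_on_def refl_on_def
          total_on_def)
    from cmp show ?case
    proof
      assume "(x, m) \<in> r"
      then have "\<forall>y\<in>insert x B. (x, y) \<in> r" using m xx tr by (auto dest: transD)
      then show ?thesis by blast
    next
      assume "(m, x) \<in> r"
      then show ?thesis using m by blast
    qed
  qed
  then show ?thesis using assms(1,2) by blast
qed

lemma card_linear_orders:
  assumes "finite A"
  shows "finite {r. linear_order_on A r} \<and> card {r. linear_order_on A r} = fact (card A)"
  using assms
proof (induction "card A" arbitrary: A)
  case 0
  then have "{r. linear_order_on A r} = {{}}"
    by (auto simp: linear_order_on_def partial_order_on_def preorder_on_def refl_on_def trans_def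
        antisym_def total_on_def)
  with 0 show ?case by simp
next
  case (Suc n)
  define L where "L A = {r. linear_order_on A r}" for A :: "'a set"
  define g where "g x r = r \<union> {x} \<times> A" for x :: 'a and r
  have ne: "A \<noteq> {}" using Suc by auto
  have IH: "finite (L (A - {x}))" "card (L (A - {x})) = fact n" if "x \<in> A" for x
  proof -
    have "n = card (A - {x})" "finite (A - {x})"
      using Suc.hyps(2) Suc.prems that by auto
    then show "finite (L (A - {x}))" "card (L (A - {x})) = fact n"
      using Suc.hyps(1)[of "A - {x}"] unfolding L_def by metis+
  qed
  have sub: "r \<subseteq> (A - {x}) \<times> (A - {x})" if "r \<in> L (A - {x})" for r x
    using that by (auto simp: L_def linear_order_on_def partial_order_on_def preorder_on_def)
  have inj: "inj_on (g x) (L (A - {x}))" for x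
  proof (rule inj_onI)
    fix r s assume "r \<in> L (A - {x})" "s \<in> L (A - {x})" "g x r = g x s"
    then show "r = s" using sub[of r x] sub[of s x] unfolding g_def by blast
  qed
  have eq: "L A = (\<Union>x\<in>A. g x ` L (A - {x}))"
  proof
    show "(\<Union>x\<in>A. g x ` L (A - {x})) \<subseteq> L A"
      by (auto simp: L_def g_def intro: linear_order_on_insert_min)
    show "L A \<subseteq> (\<Union>x\<in>A. g x ` L (A - {x}))"
    proof
      fix r assume "r \<in> L A"
      then have r: "linear_order_on A r" by (simp add: L_def)
      obtain x where x: "x \<in> A" "\<forall>y\<in>A. (x, y) \<in> r"
        using linear_order_on_has_min[OF Suc.prems ne r] by blast
      have rA: "r \<subseteq> A \<times> A" and anti: "antisym r"
        using r by (auto simp: linear_order_on_def partial_order_on_def preorder_on_def)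
      have "r = g x (r \<inter> (A - {x}) \<times> (A - {x}))"
        using rA x antisymD[OF anti] unfolding g_def by blast
      moreover have "r \<inter> (A - {x}) \<times> (A - {x}) \<in> L (A - {x})"
        using linear_order_on_remove[OF r] by (simp add: L_def)
      ultimately show "r \<in> (\<Union>x\<in>A. g x ` L (A - {x}))" using x(1) by blast
    qed
  qed
  have disj: "g x ` L (A - {x}) \<inter> g y ` L (A - {y}) = {}" if "x \<in> A" "y \<in> A" "x \<noteq> y" for x y
  proof -
    have False if "r \<in> L (A - {x})" "s \<in> L (A - {y})" "g x r = g y s" for r s
    proof -
      have "(y, x) \<in> g y s" "(y, x) \<notin> g x r"
        using \<open>x \<in> A\<close> \<open>x \<noteq> y\<close> sub[OF that(1)] by (auto simp: g_def)
      then show False using that(3) by simp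
    qed
    then show ?thesis by blast
  qed
  have "finite (L A)" unfolding eq using Suc.prems IH(1) by auto
  moreover have "card (L A) = (\<Sum>x\<in>A. card (g x ` L (A - {x})))"
    unfolding eq using Suc.prems IH(1) disj by (intro card_UN_disjoint) auto
  moreover have "\<dots> = (\<Sum>x\<in>A. fact n)"
    using IH(2) by (intro sum.cong refl) (simp add: card_image[OF inj])
  moreover have "\<dots> = fact (Suc n)" using Suc.hyps(2)[symmetric] by simp
  ultimately show ?case using Suc.hyps(2) by (simp add: L_def)
qed

lemma e_char_contraction_self:
  assumes "fin_digraph G"
  shows "e_char (contraction G G) \<beta> = (1 :: 'k::field_char_0)"
proof -
  interpret fin_digraph G by fact
  let ?C = "contraction G G"
  have arcs: "arcs ?C = {}" by (simp add: contraction_def)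
  have vs: "verts ?C = components G" by (simp add: contraction_def)
  have fin: "finite (verts ?C)" by (simp add: vs components_conv[OF wf_digraph])
  have tad: "tadpoles ?C = {}" by (simp add: tadpoles_def arcs)
  have pr: "prune ?C = ?C" by (simp add: prune_def tad)
  have cyc: "acyclic_quiver ?C"
    by (auto simp: acyclic_quiver_def pre_digraph.cycle_def pre_digraph.awalk_def arcs)
  have reach: "u \<rightarrow>\<^sup>*\<^bsub>?C\<^esub> v \<longleftrightarrow> u = v \<and> u \<in> verts ?C" for u v
  proof
    assume "u \<rightarrow>\<^sup>*\<^bsub>?C\<^esub> v"
    then show "u = v \<and> u \<in> verts ?C"
      unfolding reachable_def by (induct rule: rtrancl_on_induct) (auto simp: arcs_ends_def arcs)
  qed (auto simp: reachable_def)
  have "linear_extensions ?C = {r. linear_order_on (verts ?C) r}"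
    unfolding linear_extensions_def reach
    by (auto simp: linear_order_on_def partial_order_on_def preorder_on_def refl_on_def)
  then have "card (linear_extensions ?C) = fact (card (verts ?C))"
    using card_linear_orders[OF fin] by simp
  then show ?thesis
    by (simp add: e_char_def tad pr e0_def cyc)
qed

(* Only a witness for the existence half of ex1_omega; the guard inside the sum is for termination. *)

function omega_rec :: "('v, 'a) quiver \<Rightarrow> ('a \<Rightarrow> 'k::field_char_0) \<Rightarrow> 'k" where
  "omega_rec G \<beta> = (if fin_digraph G
     then eps_char G - (\<Sum>H\<in>{H. spanning H G \<and> H \<noteq> G}. if fin_digraph G \<and> spanning H G \<and> H \<noteq> G
       then omega_rec H \<beta> * e_char (contraction G H) \<beta> else 0)
     else 0)"
  by auto
termination
  by (relation "measure (\<lambda>(G, \<beta>). card (arcs G))") (auto intro: spanning_card_less)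

declare omega_rec.simps [simp del]

lemma sum_spanning_split:
  fixes f :: "('v, 'a) quiver \<Rightarrow> 'k::field_char_0"
  assumes "fin_digraph G"
  shows "(\<Sum>H | spanning H G. f H) = f G + (\<Sum>H | spanning H G \<and> H \<noteq> G. f H)"
proof -
  have "{H. spanning H G} = insert G {H. spanning H G \<and> H \<noteq> G}"
    using spanning_self[OF assms] by auto
  moreover have "finite {H. spanning H G \<and> H \<noteq> G}"
    using finite_spanning[OF assms] by (rule rev_finite_subset) auto
  ultimately show ?thesis by simp
qed

lemma is_omega_unfold:
  assumes "is_omega w" "fin_digraph G"
  shows "w G \<beta> = eps_char G -
    (\<Sum>H | spanning H G \<and> H \<noteq> G. w H \<beta> * e_char (contraction G H) \<beta>)"
proof -
  have "(\<Sum>H | spanning H G. w H \<beta> * e_char (contraction G H) \<beta>) = eps_char G"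
    using assms by (auto simp: is_omega_def)
  then show ?thesis
    by (simp add: sum_spanning_split[OF assms(2)] e_char_contraction_self[OF assms(2)]
        algebra_simps)
qed

lemma is_omega_omega_rec:
  "is_omega (omega_rec :: ('v, 'a) quiver \<Rightarrow> ('a \<Rightarrow> 'k::field_char_0) \<Rightarrow> 'k)"
  unfolding is_omega_def
proof (intro conjI allI impI)
  fix G :: "('v, 'a) quiver" and \<beta> :: "'a \<Rightarrow> 'k"
  assume G: "fin_digraph G"
  have "omega_rec G \<beta> = eps_char G -
      (\<Sum>H | spanning H G \<and> H \<noteq> G. omega_rec H \<beta> * e_char (contraction G H) \<beta>)"
    using G by (subst omega_rec.simps) simp
  then show "(\<Sum>H | spanning H G. omega_rec H \<beta> * e_char (contraction G H) \<beta>) = eps_char G"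
    by (simp add: sum_spanning_split[OF G] e_char_contraction_self[OF G])
next
  fix G :: "('v, 'a) quiver" and \<beta> :: "'a \<Rightarrow> 'k"
  assume "\<not> fin_digraph G"
  then show "omega_rec G \<beta> = 0" by (subst omega_rec.simps) simp
qed

lemma is_omega_unique:
  fixes w w' :: "('v, 'a) quiver \<Rightarrow> ('a \<Rightarrow> 'k::field_char_0) \<Rightarrow> 'k"
  assumes "is_omega w" "is_omega w'"
  shows "w = w'"
proof (intro ext)
  fix G :: "('v, 'a) quiver" and \<beta> :: "'a \<Rightarrow> 'k"
  show "w G \<beta> = w' G \<beta>"
  proof (induction "card (arcs G)" arbitrary: G rule: less_induct)
    case less
    show ?case
    proof (cases "fin_digraph G")
      case True
      have "w H \<beta> = w' H \<beta>" if "spanning H G" "H \<noteq> G" for H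
        using less spanning_card_less[OF True that] by blast
      then show ?thesis
        by (simp add: is_omega_unfold[OF assms(1) True] is_omega_unfold[OF assms(2) True])
    next
      case False
      then show ?thesis using assms by (auto simp: is_omega_def)
    qed
  qed
qed

theorem ex1_omega: "\<exists>!w. is_omega w"
  using is_omega_omega_rec is_omega_unique by blast

theorem omega_identity:
  assumes "fin_digraph G"
  shows "(\<Sum>H | spanning H G. omega H \<beta> * e_char (contraction G H) \<beta>) = eps_char G"
  using theI'[OF ex1_omega] assms unfolding omega_def[symmetric] by (auto simp: is_omega_def)

lemma card_orientations:
  assumes "fin_ugraph \<Gamma>" "tadpole_free \<Gamma>" "u \<in> edges \<Gamma>"
  shows "card (orientations \<Gamma> u) = 2"
proof -
  have "card (ends \<Gamma> u) = 2" using assms by (auto simp: fin_ugraph_def tadpole_free_def)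
  then obtain a b where ab: "ends \<Gamma> u = {a, b}" "a \<noteq> b" by (auto simp: card_2_iff)
  then have "orientations \<Gamma> u = {(u, a, b), (u, b, a)}"
    by (auto simp: orientations_def doubleton_eq_iff)
  then show ?thesis using ab by simp
qed

lemma card_Ori:
  assumes "fin_ugraph \<Gamma>" "tadpole_free \<Gamma>"
  shows "card (Ori \<Gamma>) = 2 ^ card (edges \<Gamma>)"
proof -
  have fst: "fst (s u) = u" if "s \<in> (\<Pi>\<^sub>E u\<in>edges \<Gamma>. orientations \<Gamma> u)" "u \<in> edges \<Gamma>" for s u
    using PiE_mem[OF that] by (auto simp: orientations_def)
  have "inj_on (\<lambda>s. oquiver \<Gamma> (s ` edges \<Gamma>)) (\<Pi>\<^sub>E u\<in>edges \<Gamma>. orientations \<Gamma> u)"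
  proof (rule inj_onI)
    fix s t
    assume s: "s \<in> (\<Pi>\<^sub>E u\<in>edges \<Gamma>. orientations \<Gamma> u)" and t: "t \<in> (\<Pi>\<^sub>E u\<in>edges \<Gamma>. orientations \<Gamma> u)"
      and "oquiver \<Gamma> (s ` edges \<Gamma>) = oquiver \<Gamma> (t ` edges \<Gamma>)"
    then have eq: "s ` edges \<Gamma> = t ` edges \<Gamma>" by (simp add: oquiver_def)
    show "s = t"
    proof (rule PiE_ext[OF s t])
      fix u assume u: "u \<in> edges \<Gamma>"
      then obtain v where v: "v \<in> edges \<Gamma>" "s u = t v" using eq by blast
      then show "s u = t u" using fst[OF s u] fst[OF t v(1)] by simp
    qed
  qed
  then have "card (Ori \<Gamma>) = card (\<Pi>\<^sub>E u\<in>edges \<Gamma>. orientations \<Gamma> u)"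
    unfolding Ori_def by (rule card_image)
  also have "\<dots> = (\<Prod>u\<in>edges \<Gamma>. card (orientations \<Gamma> u))"
    using assms by (intro card_PiE) (simp add: fin_ugraph_def)
  also have "\<dots> = 2 ^ card (edges \<Gamma>)" using card_orientations[OF assms] by simp
  finally show ?thesis .
qed

lemma wf_both_ways:
  assumes "fin_ugraph \<Gamma>" "F \<subseteq> edges \<Gamma>"
  shows "wf_digraph (both_ways \<Gamma> F)"
  using assms
  by unfold_locales (fastforce simp: both_ways_def oquiver_def orientations_def fin_ugraph_def)+

theorem tutte_1:
  assumes "fin_ugraph \<Gamma>" "uconnected \<Gamma> (edges \<Gamma>)"
  shows "tutte \<Gamma> 1 y = (\<Sum>F | F \<subseteq> edges \<Gamma> \<and> uconnected \<Gamma> F.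
    (y - 1) ^ (card F + 1 - card (nodes \<Gamma>)))"
proof -
  have one: "ncomps \<Gamma> F = 1 \<longleftrightarrow> uconnected \<Gamma> F" if "F \<subseteq> edges \<Gamma>" for F
    unfolding ncomps_def uconnected_def
    by (rule card_components_eq_1_iff[OF wf_both_ways[OF assms(1) that]])
  have pos: "ncomps \<Gamma> F > 0" if "F \<subseteq> edges \<Gamma>" for F
  proof -
    have "nodes \<Gamma> \<noteq> {}" using assms(2)
      by (auto simp: uconnected_def connected_def strongly_connected_def both_ways_def oquiver_def
          mk_symmetric_def)
    then show ?thesis
      using assms(1) unfolding ncomps_def components_conv[OF wf_both_ways[OF assms(1) that]]
      by (auto simp: card_gt_0_iff both_ways_def oquiver_def fin_ugraph_def)
  qed
  have E: "ncomps \<Gamma> (edges \<Gamma>) = 1" using one assms(2) by blast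
  have "tutte \<Gamma> 1 y = (\<Sum>F\<in>Pow (edges \<Gamma>). if uconnected \<Gamma> F
      then (y - 1) ^ (card F + 1 - card (nodes \<Gamma>)) else 0)"
    unfolding tutte_def
  proof (intro sum.cong refl)
    fix F assume "F \<in> Pow (edges \<Gamma>)"
    then have F: "F \<subseteq> edges \<Gamma>" by simp
    show "(1 - 1) ^ (ncomps \<Gamma> F - ncomps \<Gamma> (edges \<Gamma>)) *
        (y - 1) ^ (ncomps \<Gamma> F + card F - card (nodes \<Gamma>)) =
      (if uconnected \<Gamma> F then (y - 1) ^ (card F + 1 - card (nodes \<Gamma>)) else 0)"
      using one[OF F] pos[OF F] E by (auto simp: power_0_left)
  qed
  also have "\<dots> = (\<Sum>F | F \<subseteq> edges \<Gamma> \<and> uconnected \<Gamma> F. (y - 1) ^ (card F + 1 - card (nodes \<Gamma>)))"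
    using assms(1) by (subst sum.inter_filter[symmetric]) (auto simp: fin_ugraph_def Pow_def)
  finally show ?thesis .
qed

end

theory Submission
  imports Defs
begin

text \<open>
  For a set \<open>F\<close> of edges let \<open>W(F)\<close> be the sum of \<open>\<omega>\<close> over all orientations of the spanning subgraph
  \<open>(V, F)\<close>.  Summing the defining identity of \<open>\<omega>\<close> over all orientations of \<open>(V, F)\<close> decouples the
  orientation of a subset \<open>A\<close> from that of \<open>F - A\<close>.  Summed over the orientations of \<open>F - A\<close>, the
  character of the contraction of the components of \<open>(V, A)\<close> factors.  An edge inside a component
  becomes a tadpole, and its two orientations contribute \<open>- (\<beta> - 1) / 2 - (\<beta>' - 1) / 2 = 1 - b\<close>.
  The other edges contribute \<open>1\<close> altogether, because every linear order on the components is a linear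
  extension of exactly one of their orientations (\<open>sum_e0_quotient\<close>, \<open>sum_e_char_quotient\<close>).  Hence
  the sum of \<open>W(A) (1 - b)^k(A, F)\<close> over all \<open>A \<subseteq> F\<close> is \<open>1\<close> for empty \<open>F\<close> and \<open>0\<close> otherwise
  (\<open>total_omega_recursion\<close>), where \<open>k(A, F)\<close> is the number of edges of \<open>F - A\<close> that lie inside
  components of \<open>(V, A)\<close>.

  As \<open>k(F, F) = 0\<close>, this recursion determines \<open>W\<close>, and it is solved by the sum of
  \<open>(- 1)^|A| b^|F - A|\<close> over the subsets \<open>A\<close> of \<open>F\<close> that span the same components as \<open>F\<close>
  (\<open>span_sum_recursion\<close>).  Indeed, after exchanging the order of summation, the sum over the sets
  between \<open>A\<close> and \<open>F\<close> with the components of \<open>A\<close> is a binomial expansion of \<open>(b + (1 - b))^k = 1\<close>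
  (\<open>sum_intermediate\<close>), and the alternating sum over all \<open>A \<subseteq> F\<close> remains.

  For the whole edge set of a connected graph, the sets \<open>A\<close> in this solution are the connected
  spanning ones.  Since these satisfy \<open>|A| \<ge> n - 1\<close> (\<open>card_V_le\<close>), the powers of \<open>b\<close> and \<open>- 1\<close> can be
  distributed as in the specialization of the Tutte polynomial at \<open>x = 1\<close>.
\<close>

section \<open>Sums over dependent functions and over subsets\<close>

lemma sum_PiE_split:
  fixes h :: "('a \<Rightarrow> 'b) \<Rightarrow> ('a \<Rightarrow> 'b) \<Rightarrow> 'c::comm_monoid_add"
  assumes "A \<subseteq> F"
  shows "(\<Sum>s\<in>PiE F S. h (restrict s A) (restrict s (F - A))) =
    (\<Sum>f\<in>PiE A S. \<Sum>g\<in>PiE (F - A) S. h f g)"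
  unfolding sum.cartesian_product
proof (rule sum.reindex_bij_witness[of _ "\<lambda>(f, g) u. if u \<in> A then f u else g u"
      "\<lambda>s. (restrict s A, restrict s (F - A))"])
  fix s assume s: "s \<in> PiE F S"
  show "(case (restrict s A, restrict s (F - A)) of (f, g) \<Rightarrow> \<lambda>u. if u \<in> A then f u else g u) = s"
    using s assms by (fastforce simp: PiE_def extensional_def restrict_def)
  show "(restrict s A, restrict s (F - A)) \<in> PiE A S \<times> PiE (F - A) S"
    using s assms by auto
next
  fix p assume "p \<in> PiE A S \<times> PiE (F - A) S"
  then obtain f g where p: "p = (f, g)" "f \<in> PiE A S" "g \<in> PiE (F - A) S" by auto
  show "(case p of (f, g) \<Rightarrow> \<lambda>u. if u \<in> A then f u else g u) \<in> PiE F S"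
    using p assms by (auto simp: PiE_def Pi_def extensional_def)
  have "restrict (\<lambda>u. if u \<in> A then f u else g u) A = f"
    "restrict (\<lambda>u. if u \<in> A then f u else g u) (F - A) = g"
    using p by (auto simp: fun_eq_iff PiE_def extensional_def)
  then show "(restrict (case p of (f, g) \<Rightarrow> \<lambda>u. if u \<in> A then f u else g u) A,
      restrict (case p of (f, g) \<Rightarrow> \<lambda>u. if u \<in> A then f u else g u) (F - A)) = p"
    using p by simp
qed simp

lemma sum_Pow_powers:
  fixes x y :: "'k::comm_semiring_1"
  assumes "finite I"
  shows "(\<Sum>D\<in>Pow I. x ^ card D * y ^ card (I - D)) = (x + y) ^ card I"
  using prod_add[OF assms, of "\<lambda>_. x" "\<lambda>_. y"] by simp

section \<open>Linear extensions\<close>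

lemma linear_extensions_conv:
  assumes "wf_digraph Q"
  shows "linear_extensions Q =
    {r. linear_order_on (verts Q) r \<and> (\<forall>e\<in>arcs Q. (tail Q e, head Q e) \<in> r)}"
proof -
  interpret wf_digraph Q by fact
  have "{(u, v). u \<rightarrow>\<^sup>*\<^bsub>Q\<^esub> v} \<subseteq> r \<longleftrightarrow> (\<forall>e\<in>arcs Q. (tail Q e, head Q e) \<in> r)"
    if r: "linear_order_on (verts Q) r" for r
  proof
    assume sub: "{(u, v). u \<rightarrow>\<^sup>*\<^bsub>Q\<^esub> v} \<subseteq> r"
    show "\<forall>e\<in>arcs Q. (tail Q e, head Q e) \<in> r"
      using sub in_arcs_imp_in_arcs_ends by blast
  next
    assume arcs: "\<forall>e\<in>arcs Q. (tail Q e, head Q e) \<in> r"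
    have refl: "\<And>x. x \<in> verts Q \<Longrightarrow> (x, x) \<in> r" and tr: "trans r"
      using r by (auto simp: linear_order_on_def partial_order_on_def preorder_on_def refl_on_def)
    have "(u, v) \<in> r" if "u \<rightarrow>\<^sup>*\<^bsub>Q\<^esub> v" for u v
      using that
    proof (induct rule: reachable_induct)
      case base
      then show ?case by (rule refl)
    next
      case (step x y)
      then have "(x, y) \<in> r" using arcs by (auto simp: arcs_ends_conv)
      with step tr show ?case by (blast dest: transD)
    qed
    then show "{(u, v). u \<rightarrow>\<^sup>*\<^bsub>Q\<^esub> v} \<subseteq> r" by auto
  qed
  then show ?thesis unfolding linear_extensions_def by blast
qed

text \<open>In the absence of tadpoles a directed cycle leaves no linear extension at all, so that the
  acyclicity guard in \<^const>\<open>e0\<close> may be dropped.\<close>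

lemma e0_conv:
  assumes "wf_digraph Q" "tadpoles Q = {}"
  shows "e0 Q = of_nat (card (linear_extensions Q)) / fact (card (verts Q))"
proof (cases "acyclic_quiver Q")
  case False
  interpret wf_digraph Q by fact
  obtain u p where p: "awalk u p u" "p \<noteq> []"
    using False by (auto simp: acyclic_quiver_def cycle_def)
  then obtain e q where e: "p = e # q" by (cases p) auto
  have ein: "e \<in> arcs Q" "tail Q e = u" and "awalk (head Q e) q u"
    using p e by (auto simp: awalk_Cons_iff)
  then have backward: "head Q e \<rightarrow>\<^sup>*\<^bsub>Q\<^esub> tail Q e" by (auto intro: reachable_awalkI)
  have forward: "tail Q e \<rightarrow>\<^sup>*\<^bsub>Q\<^esub> head Q e" using ein in_arcs_imp_in_arcs_ends by blast
  have "linear_extensions Q = {}"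
  proof (rule ccontr)
    assume "linear_extensions Q \<noteq> {}"
    then obtain r where r: "antisym r" "{(u, v). u \<rightarrow>\<^sup>*\<^bsub>Q\<^esub> v} \<subseteq> r"
      by (auto simp: linear_extensions_def linear_order_on_def partial_order_on_def)
    then have "head Q e = tail Q e" using forward backward by (auto dest: antisymD)
    then show False using ein assms(2) by (auto simp: tadpoles_def)
  qed
  with False show ?thesis by (simp add: e0_def)
qed (simp add: e0_def)

section \<open>Orientations of a multigraph and the spanned components\<close>

text \<open>Finite undirected graphs with multiple edges and without tadpoles.\<close>

locale multigraph =
  fixes \<Gamma> :: "('v, 'e) ugraph"
  assumes fin_ugraph: "fin_ugraph \<Gamma>" and tadpole_free: "tadpole_free \<Gamma>"
begin

abbreviation "V \<equiv> nodes \<Gamma>"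

abbreviation "E \<equiv> edges \<Gamma>"

text \<open>The choices of one orientation for each edge of \<open>F\<close>; they are extensional functions on \<open>F\<close>.\<close>

definition orients :: "'e set \<Rightarrow> ('e \<Rightarrow> ('v, 'e) oedge) set" where
  "orients F = (\<Pi>\<^sub>E u\<in>F. orientations \<Gamma> u)"

text \<open>The vertex set of the connected component of \<open>v\<close> in the spanning subgraph \<open>(V, F)\<close>; it is
  empty when \<open>v\<close> is not a vertex.\<close>

definition comp_of :: "'e set \<Rightarrow> 'v \<Rightarrow> 'v set" where
  "comp_of F v = component_of (both_ways \<Gamma> F) v"

text \<open>The edges of \<open>D\<close> both ends of which have the same image under the vertex map \<open>\<kappa>\<close>, that is,
  which become tadpoles when the fibres of \<open>\<kappa>\<close> are contracted.\<close>

definition collapsed :: "('v \<Rightarrow> 'w) \<Rightarrow> 'e set \<Rightarrow> 'e set" where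
  "collapsed \<kappa> D = {u \<in> D. \<forall>x\<in>ends \<Gamma> u. \<forall>y\<in>ends \<Gamma> u. \<kappa> x = \<kappa> y}"

lemma finite_V [simp]: "finite V" and finite_E: "finite E"
  using fin_ugraph by (auto simp: fin_ugraph_def)

lemma finite_subE: "F \<subseteq> E \<Longrightarrow> finite F"
  using finite_E finite_subset by blast

lemma ends_cases:
  assumes "u \<in> E"
  obtains a b where "ends \<Gamma> u = {a, b}" "a \<noteq> b" "a \<in> V" "b \<in> V"
    "orientations \<Gamma> u = {(u, a, b), (u, b, a)}"
proof -
  have "card (ends \<Gamma> u) = 2"
    using assms fin_ugraph tadpole_free by (auto simp: fin_ugraph_def tadpole_free_def)
  then obtain a b where ab: "ends \<Gamma> u = {a, b}" "a \<noteq> b" by (auto simp: card_2_iff)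
  moreover have "a \<in> V" "b \<in> V" using ab assms fin_ugraph by (auto simp: fin_ugraph_def)
  moreover have "orientations \<Gamma> u = {(u, a, b), (u, b, a)}"
    using ab by (auto simp: orientations_def doubleton_eq_iff)
  ultimately show thesis using that by blast
qed

lemma finite_orientations: "u \<in> E \<Longrightarrow> finite (orientations \<Gamma> u)"
  by (erule ends_cases) simp

lemma orientsD:
  assumes "s \<in> orients F" "u \<in> F"
  shows "s u \<in> orientations \<Gamma> u" "fst (s u) = u" "ends \<Gamma> u = {fst (snd (s u)), snd (snd (s u))}"
proof -
  show "s u \<in> orientations \<Gamma> u" using assms unfolding orients_def by (rule PiE_mem)
  then obtain a b where "s u = (u, a, b)" "ends \<Gamma> u = {a, b}"
    unfolding orientations_def by blast
  then show "fst (s u) = u" "ends \<Gamma> u = {fst (snd (s u)), snd (snd (s u))}" by simp_all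
qed

lemma inj_on_orients: "s \<in> orients F \<Longrightarrow> inj_on s F"
  by (metis inj_onI orientsD(2))

lemma inj_on_image_orients: "inj_on (\<lambda>s. s ` F) (orients F)"
proof (rule inj_onI)
  fix s t assume s: "s \<in> orients F" and t: "t \<in> orients F" and eq: "s ` F = t ` F"
  show "s = t"
  proof (rule PiE_ext[OF s[unfolded orients_def] t[unfolded orients_def]])
    fix u assume u: "u \<in> F"
    then obtain v where v: "v \<in> F" "s u = t v" using eq by blast
    then show "s u = t u" using orientsD(2)[OF s u] orientsD(2)[OF t v(1)] by simp
  qed
qed

lemma orients_in_V:
  assumes "s \<in> orients F" "F \<subseteq> E" "u \<in> F"
  shows "fst (snd (s u)) \<in> V" "snd (snd (s u)) \<in> V"
proof -
  have "ends \<Gamma> u \<subseteq> V" using assms fin_ugraph by (auto simp: fin_ugraph_def)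
  then show "fst (snd (s u)) \<in> V" "snd (snd (s u)) \<in> V"
    unfolding orientsD(3)[OF assms(1,3)] by auto
qed

lemma fin_digraph_oquiver:
  assumes "s \<in> orients F" "F \<subseteq> E" "A \<subseteq> F"
  shows "fin_digraph (oquiver \<Gamma> (s ` A))"
proof -
  have "fst (snd (s u)) \<in> V" "snd (snd (s u)) \<in> V" if "u \<in> A" for u
    using orients_in_V[OF assms(1,2), of u] that assms(3) by auto
  then show ?thesis
    using finite_subE[of A] assms
    by unfold_locales (auto simp: oquiver_def split_beta)
qed

text \<open>Connected components do not see the orientation.\<close>

lemma comp_oquiver:
  assumes "s \<in> orients A"
  shows "component_of (oquiver \<Gamma> (s ` A)) = comp_of A"
proof -
  have *: "s u = (u, fst (snd (s u)), snd (snd (s u)))" if "u \<in> A" for u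
    using orientsD(2)[OF assms that] by (metis prod.collapse)
  have "(\<Union>e\<in>s ` A. {(fst (snd e), snd (snd e)), (snd (snd e), fst (snd e))}) =
    (\<Union>e\<in>(\<Union>u\<in>A. orientations \<Gamma> u). {(fst (snd e), snd (snd e)), (snd (snd e), fst (snd e))})"
    (is "?L = ?R")
  proof
    show "?L \<subseteq> ?R" using orientsD(1)[OF assms] by fastforce
    show "?R \<subseteq> ?L"
    proof
      fix p assume "p \<in> ?R"
      then obtain u a b where u: "u \<in> A" "ends \<Gamma> u = {a, b}" "p = (a, b) \<or> p = (b, a)"
        by (auto simp: orientations_def)
      then show "p \<in> ?L" using orientsD(3)[OF assms u(1)] by (force simp: doubleton_eq_iff)
    qed
  qed
  then have "mk_symmetric (oquiver \<Gamma> (s ` A)) = mk_symmetric (both_ways \<Gamma> A)"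
    by (simp add: mk_symmetric_def oquiver_def both_ways_def split_beta)
  then show ?thesis by (simp add: fun_eq_iff component_of_def comp_of_def)
qed

lemma comp_iff:
  assumes "F \<subseteq> E"
  shows "w \<in> comp_of F v \<longleftrightarrow> v \<rightarrow>\<^sup>*\<^bsub>mk_symmetric (both_ways \<Gamma> F)\<^esub> w"
  unfolding comp_of_def by (rule component_of_iff[OF wf_both_ways[OF fin_ugraph assms]])

lemma parcs_both_ways:
  "parcs (mk_symmetric (both_ways \<Gamma> F)) = {(x, y). \<exists>u\<in>F. ends \<Gamma> u = {x, y}}"
proof -
  have "parcs (mk_symmetric (both_ways \<Gamma> F)) =
      (\<Union>u\<in>F. \<Union>(u, x, y)\<in>orientations \<Gamma> u. {(x, y), (y, x)})"
    by (simp add: mk_symmetric_def both_ways_def oquiver_def split_beta)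
  also have "\<dots> = {(x, y). \<exists>u\<in>F. ends \<Gamma> u = {x, y}}"
    by (auto simp: orientations_def doubleton_eq_iff)
  finally show ?thesis .
qed

lemma comp_iff_rtrancl:
  assumes "F \<subseteq> E"
  shows "w \<in> comp_of F v \<longleftrightarrow> (v, w) \<in> rtrancl_on V {(x, y). \<exists>u\<in>F. ends \<Gamma> u = {x, y}}"
proof -
  have "verts (with_proj (mk_symmetric (both_ways \<Gamma> F))) = V"
    by (simp add: mk_symmetric_def both_ways_def oquiver_def)
  then show ?thesis
    unfolding comp_iff[OF assms] reachable_def by (simp add: parcs_both_ways)
qed

lemma comp_refl: "F \<subseteq> E \<Longrightarrow> v \<in> V \<Longrightarrow> v \<in> comp_of F v"
  by (simp add: comp_iff_rtrancl)

lemma comp_eqI: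
  assumes "F \<subseteq> E" "w \<in> comp_of F v"
  shows "comp_of F v = comp_of F w"
proof -
  let ?R = "{(x, y). \<exists>u\<in>F. ends \<Gamma> u = {x, y}}"
  have "sym ?R" by (simp add: sym_def doubleton_eq_iff) blast
  then have sym: "sym (rtrancl_on V ?R)" by (rule rtrancl_on_sym)
  have vw: "(v, w) \<in> rtrancl_on V ?R" using assms by (simp add: comp_iff_rtrancl)
  have "(v, x) \<in> rtrancl_on V ?R \<longleftrightarrow> (w, x) \<in> rtrancl_on V ?R" for x
    using vw symD[OF sym vw] by (meson rtrancl_on_trans)
  then show ?thesis by (auto simp: comp_iff_rtrancl[OF assms(1)])
qed

lemma comp_ends:
  assumes "F \<subseteq> E" "u \<in> F" "x \<in> ends \<Gamma> u" "y \<in> ends \<Gamma> u"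
  shows "comp_of F x = comp_of F y"
proof (cases "x = y")
  case False
  have "u \<in> E" using assms by blast
  then obtain a b where "ends \<Gamma> u = {a, b}" "a \<noteq> b" "a \<in> V" "b \<in> V"
    "orientations \<Gamma> u = {(u, a, b), (u, b, a)}"
    by (rule ends_cases)
  then have "x = a \<and> y = b \<or> x = b \<and> y = a" and V: "x \<in> V" "y \<in> V"
    using assms(3,4) False by auto
  with \<open>ends \<Gamma> u = {a, b}\<close> have "ends \<Gamma> u = {x, y}" by (auto simp: doubleton_eq_iff)
  then have "(x, y) \<in> {(x, y). \<exists>u\<in>F. ends \<Gamma> u = {x, y}}" using assms(2) by blast
  from rtrancl_on_into_rtrancl_on[OF rtrancl_on_refl[OF V(1)] this V(2)]
  have "y \<in> comp_of F x" by (simp only: comp_iff_rtrancl[OF assms(1)])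
  then show ?thesis by (rule comp_eqI[OF assms(1)])
qed simp

text \<open>Enlarging an edge set leaves the components unchanged exactly when each new edge joins two
  vertices of the same component.\<close>

lemma comp_eq_iff:
  assumes "A \<subseteq> B" "B \<subseteq> E"
  shows "comp_of A = comp_of B \<longleftrightarrow> B - A \<subseteq> collapsed (comp_of A) (B - A)"
proof
  assume "comp_of A = comp_of B"
  then show "B - A \<subseteq> collapsed (comp_of A) (B - A)"
    using comp_ends[OF assms(2)] by (auto simp: collapsed_def)
next
  assume sub: "B - A \<subseteq> collapsed (comp_of A) (B - A)"
  have AE: "A \<subseteq> E" using assms by blast
  have step: "comp_of A x = comp_of A y" if "u \<in> B" "ends \<Gamma> u = {x, y}" for u x y
  proof (cases "u \<in> A")
    case True
    then show ?thesis using comp_ends[OF AE True, of x y] that by simp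
  next
    case False
    then show ?thesis using sub that by (auto simp: collapsed_def)
  qed
  have "w \<in> comp_of A v \<longleftrightarrow> w \<in> comp_of B v" for v w
  proof
    assume "w \<in> comp_of A v"
    then show "w \<in> comp_of B v"
      unfolding comp_iff_rtrancl[OF AE] comp_iff_rtrancl[OF assms(2)]
      by (rule rtrancl_on_mono[rotated 2]) (use assms in auto)
  next
    assume "w \<in> comp_of B v"
    then have vw: "(v, w) \<in> rtrancl_on V {(x, y). \<exists>u\<in>B. ends \<Gamma> u = {x, y}}"
      by (simp add: comp_iff_rtrancl assms)
    then have "comp_of A v = comp_of A w"
      by (induct rule: rtrancl_on_induct) (use step in auto)
    then show "w \<in> comp_of A v" using in_rtrancl_on_in_F(2)[OF vw] comp_refl[OF AE] by blast
  qed
  then show "comp_of A = comp_of B" by (auto simp: fun_eq_iff)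
qed

section \<open>Summing the character over all orientations of a quotient\<close>

text \<open>The quiver obtained by mapping the vertices along \<open>\<kappa>\<close> and keeping the oriented edges \<open>D\<close>.
  For \<open>\<kappa> = comp_of A\<close> it is the contraction of the components of \<open>(V, A)\<close>; unlike the contraction it
  does not depend on how the edges of \<open>A\<close> are oriented.\<close>

definition quotient :: "('v \<Rightarrow> 'w) \<Rightarrow> ('v, 'e) oedge set \<Rightarrow> ('w, ('v, 'e) oedge) quiver" where
  "quotient \<kappa> D = \<lparr> verts = \<kappa> ` V, arcs = D,
     tail = (\<lambda>(u, a, b). \<kappa> a), head = (\<lambda>(u, a, b). \<kappa> b) \<rparr>"

lemma contraction_oquiver:
  assumes "s \<in> orients F" "F \<subseteq> E" "A \<subseteq> F"
  shows "contraction (oquiver \<Gamma> (s ` F)) (oquiver \<Gamma> (s ` A)) = quotient (comp_of A) (s ` (F - A))"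
proof -
  have "restrict s A \<in> orients A" "restrict s A ` A = s ` A"
    using assms by (auto simp: orients_def)
  then have c: "component_of (oquiver \<Gamma> (s ` A)) = comp_of A"
    using comp_oquiver[of "restrict s A" A] by simp
  have "wf_digraph (oquiver \<Gamma> (s ` A))"
    using fin_digraph_oquiver[OF assms] by (simp add: fin_digraph_def)
  then have "components (oquiver \<Gamma> (s ` A)) = comp_of A ` V"
    by (simp add: components_conv c) (simp add: oquiver_def)
  moreover have "s ` F - s ` A = s ` (F - A)"
    using inj_on_image_set_diff[OF inj_on_orients[OF assms(1)], of F A] assms by auto
  ultimately show ?thesis
    by (simp add: contraction_def quotient_def c) (simp add: oquiver_def fun_eq_iff)
qed

text \<open>Each linear order on the vertices of the quotient is a linear extension of exactly one
  orientation of the edges, because every edge can be directed upwards in just one way.\<close>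

lemma sum_e0_quotient:
  assumes D: "D \<subseteq> E" and nt: "collapsed \<kappa> D = {}"
  shows "(\<Sum>f\<in>orients D. e0 (quotient \<kappa> (f ` D))) = (1 :: 'k::field_char_0)"
proof -
  let ?X = "\<kappa> ` V"
  let ?up = "\<lambda>r u. {\<epsilon> \<in> orientations \<Gamma> u. (\<kappa> (fst (snd \<epsilon>)), \<kappa> (snd (snd \<epsilon>))) \<in> r}"
  have finX: "finite ?X" by simp
  let ?L = "{r. linear_order_on ?X r}"
  have L: "finite ?L" "card ?L = fact (card ?X)" using card_linear_orders[OF finX] by auto
  have finO: "finite (orients D)"
    unfolding orients_def using D by (intro finite_PiE finite_subE finite_orientations) auto
  have ne: "\<kappa> a \<noteq> \<kappa> b" if "u \<in> D" "ends \<Gamma> u = {a, b}" for u a b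
  proof
    assume "\<kappa> a = \<kappa> b"
    then have "u \<in> collapsed \<kappa> D" using that by (simp add: collapsed_def)
    then show False using nt by simp
  qed
  have LE: "linear_extensions (quotient \<kappa> (f ` D)) = {r\<in>?L. \<forall>u\<in>D. f u \<in> ?up r u}"
    and e0: "e0 (quotient \<kappa> (f ` D)) =
      (of_nat (card (linear_extensions (quotient \<kappa> (f ` D)))) / fact (card ?X) :: 'k)"
    if f: "f \<in> orients D" for f
  proof -
    have mem: "fst (snd (f u)) \<in> V" "snd (snd (f u)) \<in> V" if "u \<in> D" for u
      using orients_in_V[OF f D that] by auto
    have wf: "wf_digraph (quotient \<kappa> (f ` D))"
      using mem by unfold_locales (auto simp: quotient_def split_beta)
    have "\<kappa> (fst (snd (f u))) \<noteq> \<kappa> (snd (snd (f u)))" if "u \<in> D" for u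
      by (rule ne[OF that orientsD(3)[OF f that]])
    then have "\<forall>\<epsilon>\<in>f ` D. \<kappa> (fst (snd \<epsilon>)) \<noteq> \<kappa> (snd (snd \<epsilon>))" by simp
    moreover have "tadpoles (quotient \<kappa> (f ` D)) =
        {\<epsilon> \<in> f ` D. \<kappa> (fst (snd \<epsilon>)) = \<kappa> (snd (snd \<epsilon>))}"
      by (simp add: tadpoles_def quotient_def split_beta)
    ultimately have nt: "tadpoles (quotient \<kappa> (f ` D)) = {}" by blast
    have verts: "verts (quotient \<kappa> (f ` D)) = ?X" by (simp add: quotient_def)
    show "e0 (quotient \<kappa> (f ` D)) =
        (of_nat (card (linear_extensions (quotient \<kappa> (f ` D)))) / fact (card ?X) :: 'k)"
      by (simp only: e0_conv[OF wf nt] verts)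
    have "(\<forall>\<epsilon>\<in>arcs (quotient \<kappa> (f ` D)).
        (tail (quotient \<kappa> (f ` D)) \<epsilon>, head (quotient \<kappa> (f ` D)) \<epsilon>) \<in> r) \<longleftrightarrow>
      (\<forall>u\<in>D. f u \<in> ?up r u)" for r
      using orientsD(1)[OF f] by (simp add: quotient_def split_beta)
    then show "linear_extensions (quotient \<kappa> (f ` D)) = {r\<in>?L. \<forall>u\<in>D. f u \<in> ?up r u}"
      unfolding linear_extensions_conv[OF wf] verts by simp
  qed
  \<comment> \<open>the two ends of \<open>u\<close> have distinct images, and \<open>r\<close> orders them in one way\<close>
  have unique: "card (?up r u) = 1" if r: "r \<in> ?L" and u: "u \<in> D" for r u
  proof -
    have "u \<in> E" using u D by blast
    then obtain a b where ab: "ends \<Gamma> u = {a, b}" "a \<noteq> b" "a \<in> V" "b \<in> V"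
      "orientations \<Gamma> u = {(u, a, b), (u, b, a)}"
      by (rule ends_cases)
    have neq: "\<kappa> a \<noteq> \<kappa> b" using ne u ab(1) by blast
    have "antisym r" "total_on ?X r"
      using r by (auto simp: linear_order_on_def partial_order_on_def)
    then have "((\<kappa> a, \<kappa> b) \<in> r \<and> (\<kappa> b, \<kappa> a) \<notin> r) \<or> ((\<kappa> b, \<kappa> a) \<in> r \<and> (\<kappa> a, \<kappa> b) \<notin> r)"
      using neq ab(3,4) by (auto simp: total_on_def dest: antisymD)
    then have "?up r u = {(u, a, b)} \<or> ?up r u = {(u, b, a)}" using ab(5) neq by auto
    then show ?thesis by auto
  qed
  have "(\<Sum>f\<in>orients D. card (linear_extensions (quotient \<kappa> (f ` D)))) =
      (\<Sum>f\<in>orients D. \<Sum>r\<in>?L. if \<forall>u\<in>D. f u \<in> ?up r u then 1 else 0)"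
    using L(1) by (intro sum.cong refl) (simp only: LE card_eq_sum sum.inter_filter)
  also have "\<dots> = (\<Sum>r\<in>?L. \<Sum>f\<in>orients D. if \<forall>u\<in>D. f u \<in> ?up r u then 1 else 0)"
    by (rule sum.swap)
  also have "\<dots> = (\<Sum>r\<in>?L. card {f\<in>orients D. \<forall>u\<in>D. f u \<in> ?up r u})"
    using finO by (intro sum.cong refl) (simp only: card_eq_sum sum.inter_filter)
  also have "\<dots> = (\<Sum>r\<in>?L. 1)"
  proof (intro sum.cong refl)
    fix r assume r: "r \<in> ?L"
    have "{f\<in>orients D. \<forall>u\<in>D. f u \<in> ?up r u} = (\<Pi>\<^sub>E u\<in>D. ?up r u)"
      by (auto simp: orients_def PiE_def Pi_def)
    then show "card {f\<in>orients D. \<forall>u\<in>D. f u \<in> ?up r u} = 1"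
      using unique[OF r] by (simp add: card_PiE[OF finite_subE[OF D]])
  qed
  also have "\<dots> = fact (card ?X)" using L(2) by simp
  finally have "(\<Sum>f\<in>orients D. card (linear_extensions (quotient \<kappa> (f ` D)))) = fact (card ?X)" .
  then have "(\<Sum>f\<in>orients D. of_nat (card (linear_extensions (quotient \<kappa> (f ` D)))) :: 'k) =
      fact (card ?X)"
    by (simp flip: of_nat_sum)
  then show ?thesis by (simp add: e0 flip: sum_divide_distrib)
qed

end

text \<open>The two orientations of each edge carry parameters with the same mean \<open>b\<close>.\<close>

locale constant_mean = multigraph \<Gamma> for \<Gamma> :: "('v, 'e) ugraph" +
  fixes \<beta> :: "('v, 'e) oedge \<Rightarrow> 'k::field_char_0" and b :: 'k
  assumes mean: "\<And>u. u \<in> edges \<Gamma> \<Longrightarrow> mean_param \<Gamma> \<beta> u = b"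
begin

lemma sum_beta_minus:
  assumes "u \<in> E"
  shows "(\<Sum>\<epsilon>\<in>orientations \<Gamma> u. - beta_minus \<beta> \<epsilon>) = 1 - b"
proof -
  obtain x y where "ends \<Gamma> u = {x, y}" and xy: "x \<noteq> y" and "x \<in> V" "y \<in> V"
    and o: "orientations \<Gamma> u = {(u, x, y), (u, y, x)}"
    using assms by (rule ends_cases)
  then have "\<beta> (u, x, y) + \<beta> (u, y, x) = 2 * b"
    using mean[OF assms] xy by (simp add: mean_param_def o)
  moreover have "(\<Sum>\<epsilon>\<in>orientations \<Gamma> u. - beta_minus \<beta> \<epsilon>) =
      1 - (\<beta> (u, x, y) + \<beta> (u, y, x)) / 2"
    using xy by (simp add: o beta_minus_def diff_divide_distrib add_divide_distrib)
  ultimately show ?thesis by simp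
qed

text \<open>The tadpoles of the quotient contribute \<open>1 - b\<close> each, the remaining edges contribute the
  factor \<open>1\<close> in total.\<close>

lemma sum_e_char_quotient:
  assumes D: "D \<subseteq> E"
  shows "(\<Sum>g\<in>orients D. e_char (quotient \<kappa> (g ` D)) \<beta>) = (1 - b) ^ card (collapsed \<kappa> D)"
proof -
  let ?T = "collapsed \<kappa> D" and ?N = "D - collapsed \<kappa> D"
  have TD: "?T \<subseteq> D" by (auto simp: collapsed_def)
  have finT: "finite ?T" using finite_subE[OF D] TD finite_subset by blast
  let ?h = "\<lambda>f g. (\<Prod>u\<in>?T. - beta_minus \<beta> (f u)) * e0 (quotient \<kappa> (g ` ?N))"
  have e: "e_char (quotient \<kappa> (g ` D)) \<beta> = ?h (restrict g ?T) (restrict g ?N)"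
    if g: "g \<in> orients D" for g
  proof -
    have inj: "inj_on g D" by (rule inj_on_orients[OF g])
    have iff: "\<kappa> (fst (snd (g u))) = \<kappa> (snd (snd (g u))) \<longleftrightarrow> u \<in> ?T" if "u \<in> D" for u
      using orientsD(3)[OF g that] that by (auto simp: collapsed_def)
    have tad: "tadpoles (quotient \<kappa> (g ` D)) = g ` ?T"
      using iff TD by (auto simp: tadpoles_def quotient_def split_beta)
    have "g ` D - g ` ?T = g ` ?N"
      using inj_on_image_set_diff[OF inj, of D ?T] TD by auto
    then have "prune (quotient \<kappa> (g ` D)) = quotient \<kappa> (g ` ?N)"
      by (simp add: prune_def tad) (simp add: quotient_def)
    moreover have "(\<Prod>\<epsilon>\<in>g ` ?T. - beta_minus \<beta> \<epsilon>) = (\<Prod>u\<in>?T. - beta_minus \<beta> (g u))"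
      using prod.reindex[OF inj_on_subset[OF inj TD]] by simp
    ultimately show ?thesis by (simp add: e_char_def tad)
  qed
  have "collapsed \<kappa> ?N = {}" by (auto simp: collapsed_def)
  then have N: "(\<Sum>g\<in>orients ?N. e0 (quotient \<kappa> (g ` ?N))) = (1 :: 'k)"
    using D by (intro sum_e0_quotient) auto
  have "(\<Sum>g\<in>orients D. e_char (quotient \<kappa> (g ` D)) \<beta>) =
      (\<Sum>g\<in>orients D. ?h (restrict g ?T) (restrict g ?N))"
    using e by (rule sum.cong[OF refl])
  also have "\<dots> = (\<Sum>f\<in>orients ?T. \<Sum>g\<in>orients ?N. ?h f g)"
    unfolding orients_def by (rule sum_PiE_split[OF TD])
  also have "\<dots> = (\<Sum>f\<in>orients ?T. \<Prod>u\<in>?T. - beta_minus \<beta> (f u))"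
    by (simp add: N flip: sum_distrib_left)
  also have "\<dots> = (\<Prod>u\<in>?T. \<Sum>\<epsilon>\<in>orientations \<Gamma> u. - beta_minus \<beta> \<epsilon>)"
    unfolding orients_def
    by (rule prod_sum_PiE[symmetric, OF finT]) (use D TD finite_orientations in blast)
  also have "\<dots> = (\<Prod>u\<in>?T. 1 - b)"
    using sum_beta_minus D TD by (intro prod.cong refl) blast
  finally show ?thesis by simp
qed

section \<open>The recursion over edge sets and its solution\<close>

text \<open>The sum of \<open>\<omega>\<close> over all orientations of the spanning subgraph \<open>(V, F)\<close>.\<close>

definition total_omega :: "'e set \<Rightarrow> 'k" where
  "total_omega F = (\<Sum>s\<in>orients F. omega (oquiver \<Gamma> (s ` F)) \<beta>)"

lemma sum_spanning_oquiver:
  assumes "s \<in> orients F" "F \<subseteq> E"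
  shows "(\<Sum>H | spanning H (oquiver \<Gamma> (s ` F)). h H) = (\<Sum>A\<in>Pow F. h (oquiver \<Gamma> (s ` A)))"
proof -
  have wf: "wf_digraph (oquiver \<Gamma> (s ` F))"
    using fin_digraph_oquiver[OF assms order_refl] by (simp add: fin_digraph_def)
  have upd: "(oquiver \<Gamma> X)\<lparr>arcs := Y\<rparr> = oquiver \<Gamma> Y" "arcs (oquiver \<Gamma> X) = X" for X Y
    by (simp_all add: oquiver_def)
  have "{H. spanning H (oquiver \<Gamma> (s ` F))} = oquiver \<Gamma> ` Pow (s ` F)"
    unfolding spanning_iff[OF wf] upd by blast
  also have "\<dots> = (\<lambda>A. oquiver \<Gamma> (s ` A)) ` Pow F"
    by (simp add: image_image flip: image_Pow_surj[OF refl])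
  finally have "{H. spanning H (oquiver \<Gamma> (s ` F))} = (\<lambda>A. oquiver \<Gamma> (s ` A)) ` Pow F" .
  moreover have "inj_on (\<lambda>A. oquiver \<Gamma> (s ` A)) (Pow F)"
    using inj_on_image_Pow[OF inj_on_orients[OF assms(1)]]
    by (auto simp: inj_on_def oquiver_def)
  ultimately show ?thesis by (simp add: sum.reindex)
qed

lemma total_omega_recursion:
  assumes F: "F \<subseteq> E"
  shows "(\<Sum>A\<in>Pow F. total_omega A * (1 - b) ^ card (collapsed (comp_of A) (F - A))) =
    (if F = {} then 1 else 0)"
proof -
  have "(\<Sum>A\<in>Pow F. total_omega A * (1 - b) ^ card (collapsed (comp_of A) (F - A))) =
      (\<Sum>A\<in>Pow F. \<Sum>f\<in>orients A. \<Sum>g\<in>orients (F - A).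
        omega (oquiver \<Gamma> (f ` A)) \<beta> * e_char (quotient (comp_of A) (g ` (F - A))) \<beta>)"
  proof (intro sum.cong refl)
    fix A assume "A \<in> Pow F"
    have "F - A \<subseteq> E" using F by blast
    from sum_e_char_quotient[OF this, of "comp_of A"]
    show "total_omega A * (1 - b) ^ card (collapsed (comp_of A) (F - A)) =
      (\<Sum>f\<in>orients A. \<Sum>g\<in>orients (F - A).
        omega (oquiver \<Gamma> (f ` A)) \<beta> * e_char (quotient (comp_of A) (g ` (F - A))) \<beta>)"
      by (simp add: total_omega_def sum_distrib_right flip: sum_distrib_left)
  qed
  \<comment> \<open>an orientation of \<open>F\<close> is a pair of independent orientations of \<open>A\<close> and \<open>F - A\<close>\<close>
  also have "\<dots> = (\<Sum>A\<in>Pow F. \<Sum>s\<in>orients F.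
        omega (oquiver \<Gamma> (s ` A)) \<beta> * e_char (quotient (comp_of A) (s ` (F - A))) \<beta>)"
  proof (rule sum.cong[OF refl])
    fix A assume "A \<in> Pow F"
    then have "A \<subseteq> F" by simp
    from sum_PiE_split[OF this, of "\<lambda>f g. omega (oquiver \<Gamma> (f ` A)) \<beta> *
        e_char (quotient (comp_of A) (g ` (F - A))) \<beta>" "orientations \<Gamma>"]
    show "(\<Sum>f\<in>orients A. \<Sum>g\<in>orients (F - A).
        omega (oquiver \<Gamma> (f ` A)) \<beta> * e_char (quotient (comp_of A) (g ` (F - A))) \<beta>) =
      (\<Sum>s\<in>orients F.
        omega (oquiver \<Gamma> (s ` A)) \<beta> * e_char (quotient (comp_of A) (s ` (F - A))) \<beta>)"
      by (simp add: orients_def)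
  qed
  also have "\<dots> = (\<Sum>s\<in>orients F. \<Sum>A\<in>Pow F.
        omega (oquiver \<Gamma> (s ` A)) \<beta> * e_char (quotient (comp_of A) (s ` (F - A))) \<beta>)"
    by (rule sum.swap)
  also have "\<dots> = (\<Sum>s\<in>orients F. if F = {} then 1 else 0)"
  proof (intro sum.cong refl)
    fix s assume s: "s \<in> orients F"
    let ?G = "oquiver \<Gamma> (s ` F)"
    have "(\<Sum>A\<in>Pow F.
        omega (oquiver \<Gamma> (s ` A)) \<beta> * e_char (quotient (comp_of A) (s ` (F - A))) \<beta>) =
      (\<Sum>A\<in>Pow F. omega (oquiver \<Gamma> (s ` A)) \<beta> *
        e_char (contraction ?G (oquiver \<Gamma> (s ` A))) \<beta>)"
      by (intro sum.cong refl) (simp add: contraction_oquiver[OF s F])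
    also have "\<dots> = (\<Sum>H | spanning H ?G. omega H \<beta> * e_char (contraction ?G H) \<beta>)"
      by (rule sum_spanning_oquiver[OF s F, symmetric])
    also have "\<dots> = eps_char ?G"
      by (rule omega_identity[OF fin_digraph_oquiver[OF s F order_refl]])
    also have "\<dots> = (if F = {} then 1 else 0)" by (simp add: eps_char_def oquiver_def)
    finally show "(\<Sum>A\<in>Pow F.
        omega (oquiver \<Gamma> (s ` A)) \<beta> * e_char (quotient (comp_of A) (s ` (F - A))) \<beta>) =
      (if F = {} then 1 else 0)" .
  qed
  also have "\<dots> = (if F = {} then 1 else 0)" by (simp add: orients_def)
  finally show ?thesis .
qed

text \<open>The closed form: a sum over the subsets of \<open>F\<close> that span the same components as \<open>F\<close>.\<close>

definition span_sum :: "'e set \<Rightarrow> 'k" where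
  "span_sum F = (\<Sum>A | A \<subseteq> F \<and> comp_of A = comp_of F. (- 1) ^ card A * b ^ card (F - A))"

text \<open>The sets \<open>B\<close> between \<open>A\<close> and \<open>F\<close> that span the same components as \<open>A\<close> are \<open>A\<close> together with any
  set of edges of \<open>F - A\<close> lying inside these components, so that summing over \<open>B\<close> gives
  \<open>(b + (1 - b)) ^ k = 1\<close>.\<close>

lemma sum_intermediate:
  assumes "A \<subseteq> F" "F \<subseteq> E"
  shows "(\<Sum>B | A \<subseteq> B \<and> B \<subseteq> F \<and> comp_of A = comp_of B.
    b ^ card (B - A) * (1 - b) ^ card (collapsed (comp_of B) (F - B))) = 1"
proof -
  let ?I = "collapsed (comp_of A) (F - A)"
  have IF: "?I \<subseteq> F - A" by (auto simp: collapsed_def)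
  have finI: "finite ?I" using IF finite_subE[OF assms(2)] finite_subset by blast
  have same: "comp_of A = comp_of B \<longleftrightarrow> B - A \<subseteq> ?I" if "A \<subseteq> B" "B \<subseteq> F" for B
  proof -
    have "collapsed (comp_of A) (B - A) = ?I \<inter> (B - A)"
      using that unfolding collapsed_def by blast
    moreover have "B \<subseteq> E" using that assms by blast
    ultimately show ?thesis using comp_eq_iff[OF that(1)] by blast
  qed
  have rest: "collapsed (comp_of A) (F - B) = ?I - (B - A)" if "A \<subseteq> B" for B
    using that unfolding collapsed_def by blast
  have "(\<Sum>B | A \<subseteq> B \<and> B \<subseteq> F \<and> comp_of A = comp_of B.
      b ^ card (B - A) * (1 - b) ^ card (collapsed (comp_of B) (F - B))) =
    (\<Sum>D\<in>Pow ?I. b ^ card D * (1 - b) ^ card (?I - D))"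
  proof (rule sum.reindex_bij_witness[of _ "\<lambda>D. A \<union> D" "\<lambda>B. B - A"])
    fix B assume "B \<in> {B. A \<subseteq> B \<and> B \<subseteq> F \<and> comp_of A = comp_of B}"
    then have B: "A \<subseteq> B" "B \<subseteq> F" "comp_of A = comp_of B" by auto
    show "A \<union> (B - A) = B" using B by blast
    show "B - A \<in> Pow ?I" using B same by blast
    show "b ^ card (B - A) * (1 - b) ^ card (?I - (B - A)) =
        b ^ card (B - A) * (1 - b) ^ card (collapsed (comp_of B) (F - B))"
      using rest[OF B(1)] B(3) by simp
  next
    fix D assume "D \<in> Pow ?I"
    then have D: "D \<subseteq> ?I" by simp
    show eq: "A \<union> D - A = D" using D IF by blast
    show "A \<union> D \<in> {B. A \<subseteq> B \<and> B \<subseteq> F \<and> comp_of A = comp_of B}"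
      using same[of "A \<union> D"] D IF assms(1) eq by auto
  qed
  also have "\<dots> = 1" using sum_Pow_powers[OF finI, of b "1 - b"] by simp
  finally show ?thesis .
qed

lemma span_sum_recursion:
  assumes F: "F \<subseteq> E"
  shows "(\<Sum>B\<in>Pow F. span_sum B * (1 - b) ^ card (collapsed (comp_of B) (F - B))) =
    (if F = {} then 1 else 0)"
proof -
  have finF: "finite F" by (rule finite_subE[OF F])
  let ?c = "\<lambda>B. (1 - b) ^ card (collapsed (comp_of B) (F - B))"
  have "(\<Sum>B\<in>Pow F. span_sum B * ?c B) =
      (\<Sum>B\<in>Pow F. \<Sum>A | A \<in> Pow F \<and> A \<subseteq> B \<and> comp_of A = comp_of B.
        (- 1) ^ card A * (b ^ card (B - A) * ?c B))"
    unfolding span_sum_def sum_distrib_right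
    by (intro sum.cong refl) (auto simp: mult.assoc)
  also have "\<dots> = (\<Sum>A\<in>Pow F. \<Sum>B | B \<in> Pow F \<and> A \<subseteq> B \<and> comp_of A = comp_of B.
        (- 1) ^ card A * (b ^ card (B - A) * ?c B))"
    using finF by (intro sum.swap_restrict) auto
  also have "\<dots> = (\<Sum>A\<in>Pow F. (- 1) ^ card A)"
  proof (intro sum.cong refl)
    fix A assume "A \<in> Pow F"
    then have A: "A \<subseteq> F" by simp
    have "{B. B \<in> Pow F \<and> A \<subseteq> B \<and> comp_of A = comp_of B} = {B. A \<subseteq> B \<and> B \<subseteq> F \<and> comp_of A = comp_of B}"
      by auto
    then show "(\<Sum>B | B \<in> Pow F \<and> A \<subseteq> B \<and> comp_of A = comp_of B.
        (- 1) ^ card A * (b ^ card (B - A) * ?c B)) = (- 1) ^ card A"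
      using sum_intermediate[OF A F] by (simp flip: sum_distrib_left)
  qed
  also have "\<dots> = (if F = {} then 1 else 0)"
    using sum_Pow_powers[OF finF, of "- 1 :: 'k" 1] finF by (simp add: power_0_left)
  finally show ?thesis .
qed

lemma total_omega_eq_span_sum:
  assumes "F \<subseteq> E"
  shows "total_omega F = span_sum F"
  using finite_subE[OF assms] assms
proof (induction F rule: finite_psubset_induct)
  case (psubset F)
  have split: "(\<Sum>A\<in>Pow F. w A * (1 - b) ^ card (collapsed (comp_of A) (F - A))) =
      w F + (\<Sum>A\<in>Pow F - {F}. w A * (1 - b) ^ card (collapsed (comp_of A) (F - A)))"
    for w :: "'e set \<Rightarrow> 'k"
    using psubset.hyps by (subst sum.remove[of _ F]) (auto simp: collapsed_def)
  have "(\<Sum>A\<in>Pow F - {F}. total_omega A * (1 - b) ^ card (collapsed (comp_of A) (F - A))) =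
      (\<Sum>A\<in>Pow F - {F}. span_sum A * (1 - b) ^ card (collapsed (comp_of A) (F - A)))"
    using psubset by (intro sum.cong refl) auto
  then show ?case
    using trans[OF total_omega_recursion[OF psubset.prems]
        span_sum_recursion[OF psubset.prems, symmetric]]
    unfolding split by simp
qed

end

section \<open>Connected spanning subgraphs\<close>

context multigraph
begin

lemma uconnected_iff:
  assumes "F \<subseteq> E"
  shows "uconnected \<Gamma> F \<longleftrightarrow> V \<noteq> {} \<and> (\<forall>v\<in>V. comp_of F v = V)"
proof -
  have vs: "verts (with_proj (mk_symmetric (both_ways \<Gamma> F))) = V"
    by (simp add: mk_symmetric_def both_ways_def oquiver_def)
  have sub: "comp_of F v \<subseteq> V" for v
    using in_rtrancl_on_in_F(2) by (fastforce simp: comp_iff_rtrancl[OF assms])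
  have "uconnected \<Gamma> F \<longleftrightarrow> V \<noteq> {} \<and> (\<forall>v\<in>V. \<forall>w\<in>V. w \<in> comp_of F v)"
    unfolding uconnected_def connected_def strongly_connected_def vs comp_iff[OF assms] ..
  then show ?thesis using sub by blast
qed

lemma uconnected_iff_comp_eq:
  assumes "uconnected \<Gamma> E" "A \<subseteq> E"
  shows "uconnected \<Gamma> A \<longleftrightarrow> comp_of A = comp_of E"
proof -
  have out: "comp_of F v = {}" if "F \<subseteq> E" "v \<notin> V" for F v
    using that in_rtrancl_on_in_F(1) by (fastforce simp: comp_iff_rtrancl)
  have "comp_of A = comp_of E \<longleftrightarrow> (\<forall>v\<in>V. comp_of A v = comp_of E v)"
    using out[OF assms(2)] out[OF order_refl] by (metis ext)
  then show ?thesis using assms by (simp add: uconnected_iff)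
qed

text \<open>A connected graph has at least \<open>n - 1\<close> edges.  A largest vertex set \<open>S\<close> that contains a given
  vertex and satisfies the bound for its induced subgraph must be everything, since an edge leaving
  \<open>S\<close> would allow to add its other end.\<close>

lemma card_V_le:
  assumes A: "A \<subseteq> E" and conn: "uconnected \<Gamma> A"
  shows "card V \<le> card A + 1"
proof -
  obtain v where v: "v \<in> V" "comp_of A v = V" using conn by (auto simp: uconnected_iff[OF A])
  have finA: "finite A" by (rule finite_subE[OF A])
  define ind where "ind S = {u \<in> A. ends \<Gamma> u \<subseteq> S}" for S
  let ?P = "\<lambda>S. v \<in> S \<and> S \<subseteq> V \<and> card S \<le> card (ind S) + 1"
  have "?P {v}" using v by simp
  moreover have "\<forall>S. ?P S \<longrightarrow> card S < card V + 1" by (simp add: card_mono less_Suc_eq_le)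
  ultimately obtain S where S: "?P S" and max: "\<forall>T. ?P T \<longrightarrow> card T \<le> card S"
    using ex_has_greatest_nat[of ?P "{v}" card "card V + 1"] by (auto simp: less_imp_le)
  have finS: "finite S" using S finite_subset finite_V by blast
  have closed: "y \<in> S" if u: "u \<in> A" "ends \<Gamma> u = {x, y}" and x: "x \<in> S" for u x y
  proof (rule ccontr)
    assume y: "y \<notin> S"
    have yV: "y \<in> V" using u A fin_ugraph by (auto simp: fin_ugraph_def)
    have "insert u (ind S) \<subseteq> ind (insert y S)" "u \<notin> ind S"
      using u x y by (auto simp: ind_def)
    moreover have "finite (ind (insert y S))" "finite (ind S)" using finA by (auto simp: ind_def)
    ultimately have "card (ind S) + 1 \<le> card (ind (insert y S))"
      by (metis Suc_eq_plus1 card_insert_disjoint card_mono)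
    then have "?P (insert y S)" using S yV y finS by simp
    then have "card (insert y S) \<le> card S" using max by blast
    then show False using y finS by simp
  qed
  have "V \<subseteq> S"
  proof
    fix w assume "w \<in> V"
    then have "(v, w) \<in> rtrancl_on V {(x, y). \<exists>u\<in>A. ends \<Gamma> u = {x, y}}"
      using v by (simp flip: comp_iff_rtrancl[OF A])
    then show "w \<in> S" by (induct rule: rtrancl_on_induct) (use S closed in blast)+
  qed
  then have "card V \<le> card (ind V) + 1" using S by (metis subset_antisym)
  moreover have "card (ind V) \<le> card A" using finA by (auto simp: ind_def intro: card_mono)
  ultimately show ?thesis by simp
qed

lemma connected_oquiver:
  assumes "s \<in> orients F" "F \<subseteq> E" "uconnected \<Gamma> F"
  shows "connected (oquiver \<Gamma> (s ` F))"
proof -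
  have wf: "wf_digraph (oquiver \<Gamma> (s ` F))"
    using fin_digraph_oquiver[OF assms(1,2) order_refl] by (simp add: fin_digraph_def)
  have "components (oquiver \<Gamma> (s ` F)) = comp_of F ` V"
    using components_conv[OF wf] by (simp add: comp_oquiver[OF assms(1)]) (simp add: oquiver_def)
  also have "\<dots> = {V}" using assms(3) by (auto simp: uconnected_iff[OF assms(2)])
  finally show ?thesis by (simp flip: card_components_eq_1_iff[OF wf])
qed

end

theorem mainTheorem14:
  fixes \<Gamma> :: "('v, 'e) ugraph"
    and \<beta> :: "('v, 'e) oedge \<Rightarrow> 'k::field_char_0"
    and b :: 'k
  assumes "fin_ugraph \<Gamma>"
    and "uconnected \<Gamma> (edges \<Gamma>)"
    and "tadpole_free \<Gamma>"
    and "\<And>u. u \<in> edges \<Gamma> \<Longrightarrow> mean_param \<Gamma> \<beta> u = b"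
    and "b \<noteq> 0"
  shows "(\<Sum>G\<in>Ori \<Gamma>. omega_c G \<beta>) =
    (- 1) ^ (card (nodes \<Gamma>) - 1) * b ^ (card (edges \<Gamma>) + 1 - card (nodes \<Gamma>)) *
    tutte \<Gamma> 1 (1 - 1 / b)"
proof -
  interpret constant_mean \<Gamma> \<beta> b by unfold_locales (use assms in auto)
  let ?n = "card V"
  have n: "?n > 0" using assms(2) by (auto simp: uconnected_iff card_gt_0_iff)
  have "inj_on (\<lambda>s. oquiver \<Gamma> (s ` E)) (orients E)"
    using inj_on_image_orients[of E] by (auto simp: inj_on_def oquiver_def)
  then have "(\<Sum>G\<in>Ori \<Gamma>. omega_c G \<beta>) = (\<Sum>s\<in>orients E. omega_c (oquiver \<Gamma> (s ` E)) \<beta>)"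
    by (simp add: Ori_def sum.reindex flip: orients_def)
  also have "\<dots> = total_omega E"
    unfolding total_omega_def
    by (intro sum.cong refl) (simp add: omega_c_def connected_oquiver assms(2))
  also have "\<dots> = span_sum E" by (rule total_omega_eq_span_sum) simp
  also have "\<dots> = (\<Sum>A | A \<subseteq> E \<and> uconnected \<Gamma> A. (- 1) ^ card A * b ^ card (E - A))"
    unfolding span_sum_def using uconnected_iff_comp_eq[OF assms(2)]
    by (intro sum.cong refl) auto
  also have "\<dots> = (\<Sum>A | A \<subseteq> E \<and> uconnected \<Gamma> A.
      (- 1) ^ (?n - 1) * b ^ (card E + 1 - ?n) * (- 1 / b) ^ (card A + 1 - ?n))"
  proof (intro sum.cong refl)
    fix A assume "A \<in> {A. A \<subseteq> E \<and> uconnected \<Gamma> A}"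
    then have A: "A \<subseteq> E" "uconnected \<Gamma> A" by auto
    \<comment> \<open>\<open>k\<close> is the exponent of \<open>y - 1 = - 1 / b\<close>; no subtraction truncates, by \<open>card_V_le\<close>\<close>
    define k where "k = card A + 1 - ?n"
    define d where "d = card (E - A)"
    have "card A = (?n - 1) + k" using card_V_le[OF A] n by (simp add: k_def)
    moreover have "card E + 1 - ?n = k + d"
      using card_V_le[OF A] card_mono[OF finite_E A(1)] card_Diff_subset[OF finite_subE[OF A(1)] A(1)]
      by (simp add: k_def d_def)
    moreover have "b ^ k * (- 1 / b) ^ k = (- 1) ^ k"
      using \<open>b \<noteq> 0\<close> by (simp flip: power_mult_distrib)
    ultimately show "(- 1) ^ card A * b ^ card (E - A) =
        (- 1) ^ (?n - 1) * b ^ (card E + 1 - ?n) * (- 1 / b) ^ (card A + 1 - ?n)"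
      unfolding k_def[symmetric] d_def[symmetric] by (simp add: power_add mult_ac)
  qed
  also have "\<dots> = (- 1) ^ (?n - 1) * b ^ (card E + 1 - ?n) * tutte \<Gamma> 1 (1 - 1 / b)"
    unfolding tutte_1[OF assms(1,2)] by (simp add: sum_distrib_left)
  finally show ?thesis .
qed

end
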